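(* Let $n \ge m \ge 1$ and $t\ge 2$ be integers. Let $\Delta_{m,n}$ be the $m\times n$ chessboard complex and $I_{\Delta_{m,n}}$ its Stanley--Reisner ideal. Then the $\mathrm{v}$-number of the $t$-th ordinary power of $I_{\Delta_{m,n}}$ is \[ \mathrm{v}(I_{\Delta_{m,n}}^t)= \begin{cases} 0, & \text{if } m=n=1,\\ m, & \text{if } n \ge m \ge 4 \text{ and } 2\le t\le \frac{m}{2},\\ 2t-1, & \text{if } n\ge 2 \text{ and } m=1,\\ 2t-1, & \text{if } n \ge m\ge 2 \text{ and } t\ge \frac{m+1}{2}. \end{cases} \]
   Context: Let $\mathbb{K}$ be a field and $S=\mathbb{K}[x_{i,j}\mid 1\le i\le m,\ 1\le j\le n]$ the standard graded polynomial ring, $S_d$ its degree $d$ component. The variable $x_{i,j}$ is identified with the square in row $i$ and column $j$ of an $m\times n$ chessboard. Chessboard complex: $\Delta_{m,n}$ is the simplicial complex on the vertex set $V=\{x_{i,j}\mid 1\le i\le m,\ 1\le j\le n\}$ whose faces are the subsets of $V$ with no two squares in the same row or the same column. Stanley--Reisner ideal: for $F\subseteq V$ put $\mathbf{x}_F=\prod_{x\in F}x$. Then $I_{\Delta_{m,n}}=(\mathbf{x}_F\mid F\subseteq V,\ F\notin\Delta_{m,n})\subseteq S$. $\mathrm{v}$-number: for a graded ideal $I\subseteq S$, let $\operatorname{Ass}(I)$ be the set of associated primes of $I$ (i.e. of $S/I$). For $\mathfrak{p}\in\operatorname{Ass}(I)$ let $\mathrm{v}_{\mathfrak{p}}(I)=\min\{d\ge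 0\mid \text{there exists } f\in S_d \text{ with } (I:f)=\mathfrak{p}\}$, and let $\mathrm{v}(I)=\min\{\mathrm{v}_{\mathfrak{p}}(I)\mid \mathfrak{p}\in\operatorname{Ass}(I)\}$. *)

theory Defs
  imports
    "HOL-Algebra.Ideal_Product"
    "HOL-Library.Poly_Mapping"
    "HOL-Library.Extended_Nat"
begin

section \<open>Polynomial rings\<close>

text \<open>
  A monomial is a finitely supported exponent vector, and a polynomial is a finitely supported
  map from monomials to coefficients; \<^theory>\<open>HOL-Library.Poly_Mapping\<close> supplies the
  (convolution) multiplication.
\<close>

type_synonym ('x, 'k) mpoly = "('x \<Rightarrow>\<^sub>0 nat) \<Rightarrow>\<^sub>0 'k"

definition poly_ring :: "'x set \<Rightarrow> ('x, 'k::field) mpoly ring" where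
  "poly_ring X =
     \<lparr> carrier = {f. \<forall>\<alpha>\<in>Poly_Mapping.keys f. Poly_Mapping.keys \<alpha> \<subseteq> X},
       mult = (*), one = 1, zero = 0, add = (+) \<rparr>"

definition mon_degree :: "('x \<Rightarrow>\<^sub>0 nat) \<Rightarrow> nat" where
  "mon_degree \<alpha> = (\<Sum>x\<in>Poly_Mapping.keys \<alpha>. Poly_Mapping.lookup \<alpha> x)"

text \<open>As usual, the zero polynomial belongs to every graded component.\<close>

definition graded_component :: "'x set \<Rightarrow> nat \<Rightarrow> ('x, 'k::field) mpoly set" where
  "graded_component X d = {f \<in> carrier (poly_ring X). \<forall>\<alpha>\<in>Poly_Mapping.keys f. mon_degree \<alpha> = d}"

definition pvar :: "'x \<Rightarrow> ('x, 'k::field) mpoly" where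
  "pvar x = Poly_Mapping.single (Poly_Mapping.single x 1) 1"

lemma cring_poly_ring: "cring (poly_ring X :: ('x, 'k::field) mpoly ring)"
proof (rule cringI)
  show "abelian_group (poly_ring X :: ('x, 'k) mpoly ring)"
  proof (rule abelian_groupI)
    fix f g :: "('x, 'k) mpoly"
    assume "f \<in> carrier (poly_ring X)" "g \<in> carrier (poly_ring X)"
    then show "f \<oplus>\<^bsub>poly_ring X\<^esub> g \<in> carrier (poly_ring X)"
      using Poly_Mapping.keys_add[of f g] by (force simp: poly_ring_def)
  next
    fix f :: "('x, 'k) mpoly"
    assume "f \<in> carrier (poly_ring X)"
    then have "- f \<in> carrier (poly_ring X)" "- f \<oplus>\<^bsub>poly_ring X\<^esub> f = \<zero>\<^bsub>poly_ring X\<^esub>"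
      by (auto simp: poly_ring_def)
    then show "\<exists>g\<in>carrier (poly_ring X). g \<oplus>\<^bsub>poly_ring X\<^esub> f = \<zero>\<^bsub>poly_ring X\<^esub>"
      by blast
  qed (auto simp: poly_ring_def algebra_simps)
next
  show "Group.comm_monoid (poly_ring X :: ('x, 'k) mpoly ring)"
  proof (rule comm_monoidI)
    fix f g :: "('x, 'k) mpoly"
    assume fg: "f \<in> carrier (poly_ring X)" "g \<in> carrier (poly_ring X)"
    have "Poly_Mapping.keys \<gamma> \<subseteq> X" if "\<gamma> \<in> Poly_Mapping.keys (f * g)" for \<gamma>
    proof -
      from that Poly_Mapping.keys_mult[of f g] obtain \<alpha> \<beta>
        where "\<alpha> \<in> Poly_Mapping.keys f" "\<beta> \<in> Poly_Mapping.keys g" "\<gamma> = \<alpha> + \<beta>" by blast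
      with fg show ?thesis
        using Poly_Mapping.keys_add[of \<alpha> \<beta>] by (force simp: poly_ring_def)
    qed
    then show "f \<otimes>\<^bsub>poly_ring X\<^esub> g \<in> carrier (poly_ring X)"
      by (simp add: poly_ring_def)
  qed (auto simp: poly_ring_def algebra_simps)
qed (auto simp: poly_ring_def algebra_simps)


section \<open>Associated primes and the v-number\<close>

definition colon_ideal :: "('a, 'b) ring_scheme \<Rightarrow> 'a set \<Rightarrow> 'a \<Rightarrow> 'a set" where
  "colon_ideal R I f = {g \<in> carrier R. g \<otimes>\<^bsub>R\<^esub> f \<in> I}"

text \<open>
  The associated primes of \<open>R/I\<close>: the colon ideal \<open>(I : f)\<close> is the annihilator of
  the residue class of \<open>f\<close>.
\<close>

definition associated_primes :: "('a, 'b) ring_scheme \<Rightarrow> 'a set \<Rightarrow> 'a set set" where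
  "associated_primes R I = {P. primeideal P R \<and> (\<exists>f\<in>carrier R. P = colon_ideal R I f)}"

text \<open>
  The minima are taken in \<^typ>\<open>enat\<close>, where the infimum of a nonempty set of naturals is its
  minimum and the infimum of the empty set is \<open>\<infinity>\<close>; so a finite value is always attained.
\<close>

definition local_v_number :: "'x set \<Rightarrow> ('x, 'k::field) mpoly set \<Rightarrow> ('x, 'k) mpoly set \<Rightarrow> enat" where
  "local_v_number X I P =
     (INF d \<in> {d. \<exists>f\<in>graded_component X d. colon_ideal (poly_ring X) I f = P}. enat d)"

definition v_number :: "'x set \<Rightarrow> ('x, 'k::field) mpoly set \<Rightarrow> enat" where
  "v_number X I = (INF P \<in> associated_primes (poly_ring X) I. local_v_number X I P)"


section \<open>Chessboard complexes and Stanley--Reisner ideals\<close>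

definition chessboard :: "nat \<Rightarrow> nat \<Rightarrow> (nat \<times> nat) set" where
  "chessboard m n = {1..m} \<times> {1..n}"

definition chessboard_complex :: "nat \<Rightarrow> nat \<Rightarrow> (nat \<times> nat) set set" where
  "chessboard_complex m n =
     {F. F \<subseteq> chessboard m n \<and>
         (\<forall>a\<in>F. \<forall>b\<in>F. a \<noteq> b \<longrightarrow> fst a \<noteq> fst b \<and> snd a \<noteq> snd b)}"

definition stanley_reisner_ideal :: "'x set \<Rightarrow> 'x set set \<Rightarrow> ('x, 'k::field) mpoly set" where
  "stanley_reisner_ideal V \<Delta> = Idl\<^bsub>poly_ring V\<^esub> {\<Prod>x\<in>F. pvar x | F. F \<subseteq> V \<and> F \<notin> \<Delta>}"

text \<open>
  Ordinary powers are powers in the multiplicative monoid \<^const>\<open>ideals_set\<close> of ideals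
  under the ideal product.
\<close>

definition ideal_power :: "('a, 'b) ring_scheme \<Rightarrow> 'a set \<Rightarrow> nat \<Rightarrow> 'a set" where
  "ideal_power R I t = I [^]\<^bsub>ideals_set R\<^esub> t"

end

theory Submission
  imports Defs "HOL-Library.Product_Lexorder"
begin

text \<open>
  The Stanley--Reisner ideal \<open>I\<close> of the chessboard complex is the edge ideal of the rook's graph: it
  is generated by the products of two squares in a common row or column. A monomial lies in
  \<open>I\<^sup>t\<close> if and only if, with repeated squares counted as often as they occur, it contains \<open>t\<close>
  disjoint edges of this graph. For \<open>n \<ge> 2\<close> the theorem amounts to the single formula
  \<open>v(I\<^sup>t) = max m (2 * t - 1)\<close>; for \<open>m = n = 1\<close> the ideal is zero.

  For the lower bound, if \<open>(I\<^sup>t : f)\<close> is a prime \<open>P\<close>, then the variables in \<open>P\<close> form a vertex cover \<open>C\<close>, as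
  \<open>P\<close> contains \<open>I\<close>. Some term \<open>u\<close> of \<open>f\<close> lies outside \<open>I\<^sup>t\<close>, but \<open>x\<^sub>a u\<close> lies in \<open>I\<^sup>t\<close> for all \<open>a\<close>
  in \<open>C\<close>; the reduction is \<open>enat_le_v_number\<close>. So \<open>deg u + 1 \<ge> 2 * t\<close>. If moreover \<open>deg u < m\<close>, then
  counting the rows and columns without squares of \<open>u\<close> shows that \<open>u\<close> consists of \<open>m - 1\<close>
  non-attacking rooks, and then \<open>x\<^sub>a u\<close> cannot contain two disjoint edges; this is
  \<open>rook_lower_bound\<close>.

  For the upper bound it suffices to find a monomial \<open>u\<close> of degree \<open>max m (2 * t - 1)\<close> and a
  set \<open>F\<close> of squares such that \<open>x\<^sub>a u\<close> contains \<open>t\<close> disjoint edges for all \<open>a\<close> outside \<open>F\<close>, while no product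
  of \<open>u\<close> with squares of \<open>F\<close> does: then \<open>(I\<^sup>t : u)\<close> is generated by the variables outside
  \<open>F\<close> and is prime (\<open>v_number_le\<close>). For \<open>t < m\<close> one takes an odd clique in the first column together
  with isolated diagonal squares in the remaining rows. The clique may repeat \<open>(1, 1)\<close>, but
  for \<open>t \<ge> m\<close> this would take \<open>2 * t - m \<ge> t\<close> copies, more than the other squares of the column
  can be paired with; then a star in the first row, with the diagonal as \<open>F\<close>, takes its place.
\<close>

section \<open>Monomial ideals and their powers\<close>

text \<open>
  A constant rather than an abbreviation, to keep the simplifier from rewriting the exponent
  \<open>1\<close> to \<open>Suc 0\<close>.
\<close>

definition unit_exp :: "'x \<Rightarrow> ('x \<Rightarrow>\<^sub>0 nat)" where
  "unit_exp a = Poly_Mapping.single a 1"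

lemma lookup_unit_exp: "Poly_Mapping.lookup (unit_exp a) b = (if a = b then 1 else 0)"
  by (simp add: unit_exp_def lookup_single when_def)

lemma keys_unit_exp [simp]: "Poly_Mapping.keys (unit_exp a) = {a}"
  by (simp add: unit_exp_def)

lemma pvar_eq: "pvar a = Poly_Mapping.single (unit_exp a) 1"
  by (simp add: pvar_def unit_exp_def)

definition multiples :: "('x \<Rightarrow>\<^sub>0 nat) set \<Rightarrow> ('x \<Rightarrow>\<^sub>0 nat) set" where
  "multiples A = {\<alpha> + \<gamma> | \<alpha> \<gamma>. \<alpha> \<in> A}"

text \<open>
  The ideal generated by the monomials with exponents in \<open>A\<close>, described through its terms: a
  polynomial belongs to a monomial ideal as soon as each of its terms does. This form
  reduces questions about the ideal to exponent vectors.
\<close>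

definition monomial_ideal :: "'x set \<Rightarrow> ('x \<Rightarrow>\<^sub>0 nat) set \<Rightarrow> ('x, 'k::field) mpoly set" where
  "monomial_ideal X A = {f \<in> carrier (poly_ring X). Poly_Mapping.keys f \<subseteq> multiples A}"

lemma keys_add_nat: "Poly_Mapping.keys (\<alpha> + \<beta>) = Poly_Mapping.keys \<alpha> \<union> Poly_Mapping.keys \<beta>"
  for \<alpha> \<beta> :: "'x \<Rightarrow>\<^sub>0 nat"
  by (auto simp: in_keys_iff lookup_add)

lemma multiplesI: "\<alpha> \<in> A \<Longrightarrow> \<alpha> + \<gamma> \<in> multiples A"
  by (auto simp: multiples_def)

lemma subset_multiples: "\<alpha> \<in> A \<Longrightarrow> \<alpha> \<in> multiples A"
  using multiplesI[of \<alpha> A 0] by simp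

lemma multiples_add: "\<alpha> \<in> multiples A \<Longrightarrow> \<alpha> + \<gamma> \<in> multiples A"
  unfolding multiples_def by (auto simp: add.assoc) (metis add.assoc)

lemma carrier_poly_ring:
  "f \<in> carrier (poly_ring X) \<longleftrightarrow> (\<forall>\<alpha>\<in>Poly_Mapping.keys f. Poly_Mapping.keys \<alpha> \<subseteq> X)"
  by (simp add: poly_ring_def)

lemma poly_ring_simps [simp]:
  "mult (poly_ring X) = (*)" "add (poly_ring X) = (+)"
  "one (poly_ring X) = 1" "zero (poly_ring X) = 0"
  by (simp_all add: poly_ring_def)

lemma keys_mult_multiples:
  assumes "Poly_Mapping.keys f \<subseteq> multiples A"
  shows "Poly_Mapping.keys (f * g) \<subseteq> multiples A"
  using keys_mult[of f g] assms multiples_add by blast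

lemma poly_mapping_sum_single:
  "f = (\<Sum>\<alpha>\<in>Poly_Mapping.keys f. Poly_Mapping.single \<alpha> (Poly_Mapping.lookup f \<alpha>))"
  by (rule poly_mapping_eqI) (simp add: lookup_sum lookup_single when_def sum.delta in_keys_iff)

lemma poly_ring_closed:
  fixes f g :: "('x, 'k::field) mpoly"
  shows "0 \<in> carrier (poly_ring X :: ('x, 'k) mpoly ring)"
    and "1 \<in> carrier (poly_ring X :: ('x, 'k) mpoly ring)"
    and "f \<in> carrier (poly_ring X) \<Longrightarrow> g \<in> carrier (poly_ring X) \<Longrightarrow> f + g \<in> carrier (poly_ring X)"
    and "f \<in> carrier (poly_ring X) \<Longrightarrow> g \<in> carrier (poly_ring X) \<Longrightarrow> f * g \<in> carrier (poly_ring X)"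
  using ring.ring_simprules(1,5)[OF cring.axioms(1)[OF cring_poly_ring[of X]], of f g]
  by (simp_all add: carrier_poly_ring[of 0] carrier_poly_ring[of 1])

lemma poly_ring_ideal:
  fixes f g :: "('x, 'k::field) mpoly"
  assumes J: "ideal J (poly_ring X)"
  shows "J \<subseteq> carrier (poly_ring X)" and "0 \<in> J"
    and "f \<in> J \<Longrightarrow> g \<in> J \<Longrightarrow> f + g \<in> J"
    and "f \<in> J \<Longrightarrow> g \<in> J \<Longrightarrow> f - g \<in> J"
    and "f \<in> J \<Longrightarrow> g \<in> carrier (poly_ring X) \<Longrightarrow> f * g \<in> J"
proof -
  note add = ideal.axioms(1)[OF J]
  show "J \<subseteq> carrier (poly_ring X)" by (rule additive_subgroup.a_subset[OF add])
  show "0 \<in> J" using additive_subgroup.zero_closed[OF add] by simp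
  show plus: "f + g \<in> J" if "f \<in> J" "g \<in> J" for f g
    using additive_subgroup.a_closed[OF add that] by simp
  show mult: "f * g \<in> J" if "f \<in> J" "g \<in> carrier (poly_ring X)" for f g
    using ideal.I_r_closed[OF J that] by simp
  have "- 1 \<in> carrier (poly_ring X :: ('x, 'k) mpoly ring)" by (simp add: carrier_poly_ring)
  then show "f - g \<in> J" if "f \<in> J" "g \<in> J" for f g
    using plus[OF that(1) mult[OF that(2), of "- 1"]] by simp
qed

lemma monomial_ideal_is_ideal:
  "ideal (monomial_ideal X A :: ('x, 'k::field) mpoly set) (poly_ring X)"
proof (rule idealI)
  let ?J = "monomial_ideal X A :: ('x, 'k) mpoly set"
  note R = cring.axioms(1)[OF cring_poly_ring[of X]]
  note G = abelian_group.a_group[OF ring.is_abelian_group[OF R]]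
  show "ring (poly_ring X :: ('x, 'k) mpoly ring)" by (rule R)
  show "subgroup ?J (add_monoid (poly_ring X))"
  proof (rule group.subgroupI[OF G])
    show "?J \<subseteq> carrier (add_monoid (poly_ring X))" by (auto simp: monomial_ideal_def)
    show "?J \<noteq> {}" using poly_ring_closed(1) by (force simp: monomial_ideal_def)
  next
    fix f assume f: "f \<in> ?J"
    then have "- f \<in> ?J" by (auto simp: monomial_ideal_def carrier_poly_ring)
    moreover have "inv\<^bsub>add_monoid (poly_ring X)\<^esub> f = - f"
      by (rule group.inv_equality[OF G])
        (use f in \<open>auto simp: monomial_ideal_def carrier_poly_ring\<close>)
    ultimately show "inv\<^bsub>add_monoid (poly_ring X)\<^esub> f \<in> ?J" by simp
  next
    fix f g assume "f \<in> ?J" "g \<in> ?J"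
    then show "f \<otimes>\<^bsub>add_monoid (poly_ring X)\<^esub> g \<in> ?J"
      using poly_ring_closed(3)[of f X g] Poly_Mapping.keys_add[of f g]
      by (auto simp: monomial_ideal_def)
  qed
next
  let ?J = "monomial_ideal X A :: ('x, 'k) mpoly set"
  fix f g :: "('x, 'k) mpoly" assume f: "f \<in> ?J" and g: "g \<in> carrier (poly_ring X)"
  have "f * g \<in> ?J"
    using f g poly_ring_closed(4)[of f X g] keys_mult_multiples[of f A g]
    by (simp add: monomial_ideal_def)
  then show "f \<otimes>\<^bsub>poly_ring X\<^esub> g \<in> ?J" "g \<otimes>\<^bsub>poly_ring X\<^esub> f \<in> ?J"
    by (simp_all add: mult.commute)
qed

lemma monomial_ideal_least:
  assumes J: "ideal J (poly_ring X)"
    and A: "\<And>\<alpha>. \<alpha> \<in> A \<Longrightarrow> Poly_Mapping.single \<alpha> 1 \<in> J"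
  shows "monomial_ideal X A \<subseteq> (J :: ('x, 'k::field) mpoly set)"
proof
  fix f :: "('x, 'k) mpoly" assume f: "f \<in> monomial_ideal X A"
  have term_in: "Poly_Mapping.single \<delta> c \<in> J" if "\<delta> \<in> Poly_Mapping.keys f" for \<delta> c
  proof -
    from f that obtain \<alpha> \<gamma> where \<alpha>: "\<alpha> \<in> A" and \<delta>: "\<delta> = \<alpha> + \<gamma>"
      by (auto simp: monomial_ideal_def multiples_def)
    have "Poly_Mapping.keys \<delta> \<subseteq> X"
      using f that by (auto simp: monomial_ideal_def carrier_poly_ring)
    then have "Poly_Mapping.single \<gamma> c \<in> carrier (poly_ring X)"
      by (auto simp: carrier_poly_ring \<delta> keys_add_nat)
    from poly_ring_ideal(5)[OF J A[OF \<alpha>] this] show ?thesis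
      by (simp add: mult_single \<delta>)
  qed
  have "(\<Sum>\<alpha>\<in>S. Poly_Mapping.single \<alpha> (Poly_Mapping.lookup f \<alpha>)) \<in> J"
    if "finite S" "S \<subseteq> Poly_Mapping.keys f" for S
    using that
  proof (induction S)
    case empty
    then show ?case
      using poly_ring_ideal(2)[OF J] by simp
  next
    case (insert \<alpha> S)
    then show ?case
      using poly_ring_ideal(3)[OF J] term_in by simp
  qed
  from this[of "Poly_Mapping.keys f"] show "f \<in> J"
    using poly_mapping_sum_single[of f] by simp
qed

lemma single_in_monomial_ideal:
  "Poly_Mapping.single \<alpha> 1 \<in> (monomial_ideal X A :: ('x, 'k::field) mpoly set) \<longleftrightarrow>
    Poly_Mapping.keys \<alpha> \<subseteq> X \<and> \<alpha> \<in> multiples A"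
  by (auto simp: monomial_ideal_def carrier_poly_ring)

primrec nfold_sums :: "nat \<Rightarrow> 'a::comm_monoid_add set \<Rightarrow> 'a set" where
  "nfold_sums 0 A = {0}"
| "nfold_sums (Suc k) A = {\<alpha> + \<beta> | \<alpha> \<beta>. \<alpha> \<in> nfold_sums k A \<and> \<beta> \<in> A}"

text \<open>
  Products of generators generate the product. The inclusion from left to right compares terms:
  a term of \<open>f * g\<close> is a product of a term of \<open>f\<close> and a term of \<open>g\<close>.
\<close>

lemma monomial_ideal_prod:
  fixes X :: "'x set"
  assumes A: "\<And>\<alpha>. \<alpha> \<in> A \<Longrightarrow> Poly_Mapping.keys \<alpha> \<subseteq> X"
    and B: "\<And>\<beta>. \<beta> \<in> B \<Longrightarrow> Poly_Mapping.keys \<beta> \<subseteq> X"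
  shows "ideal_prod (poly_ring X) (monomial_ideal X A) (monomial_ideal X B) =
    (monomial_ideal X {\<alpha> + \<beta> | \<alpha> \<beta>. \<alpha> \<in> A \<and> \<beta> \<in> B} :: ('x, 'k::field) mpoly set)"
    (is "?L = monomial_ideal X ?AB")
proof
  show "?L \<subseteq> monomial_ideal X ?AB"
  proof
    fix f :: "('x, 'k) mpoly" assume "f \<in> ?L"
    then show "f \<in> monomial_ideal X ?AB"
    proof (induction f rule: ideal_prod.induct)
      case (prod f g)
      then have fg: "f \<in> carrier (poly_ring X)" "Poly_Mapping.keys f \<subseteq> multiples A"
        "g \<in> carrier (poly_ring X)" "Poly_Mapping.keys g \<subseteq> multiples B"
        by (auto simp: monomial_ideal_def)
      have "\<delta> \<in> multiples ?AB" if "\<delta> \<in> Poly_Mapping.keys (f * g)" for \<delta>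
      proof -
        from that keys_mult[of f g] obtain \<phi> \<psi>
          where "\<phi> \<in> Poly_Mapping.keys f" "\<psi> \<in> Poly_Mapping.keys g" and \<delta>: "\<delta> = \<phi> + \<psi>" by blast
        with fg obtain \<alpha> \<gamma> \<beta> \<gamma>' where "\<phi> = \<alpha> + \<gamma>" "\<alpha> \<in> A" "\<psi> = \<beta> + \<gamma>'" "\<beta> \<in> B"
          by (fastforce simp: multiples_def subset_iff)
        then have "\<delta> = (\<alpha> + \<beta>) + (\<gamma> + \<gamma>')" "\<alpha> + \<beta> \<in> ?AB" by (auto simp: \<delta> ac_simps)
        then show ?thesis using multiplesI[of "\<alpha> + \<beta>" ?AB "\<gamma> + \<gamma>'"] by simp
      qed
      with poly_ring_closed(4)[OF fg(1,3)] show ?case by (auto simp: monomial_ideal_def)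
    next
      case (sum f g)
      then show ?case
        using poly_ring_ideal(3)[OF monomial_ideal_is_ideal] by simp
    qed
  qed
  show "monomial_ideal X ?AB \<subseteq> ?L"
  proof (rule monomial_ideal_least)
    show "ideal ?L (poly_ring X)"
      using ring.ideal_prod_is_ideal[OF cring.axioms(1)[OF cring_poly_ring]] monomial_ideal_is_ideal
      by blast
    fix \<delta> assume "\<delta> \<in> ?AB"
    then obtain \<alpha> \<beta> where \<delta>: "\<alpha> \<in> A" "\<beta> \<in> B" "\<delta> = \<alpha> + \<beta>" by blast
    then have "Poly_Mapping.single \<alpha> 1 \<otimes>\<^bsub>poly_ring X\<^esub> Poly_Mapping.single \<beta> 1 \<in> ?L"
      using A B by (intro ideal_prod.prod) (auto simp: single_in_monomial_ideal subset_multiples)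
    then show "Poly_Mapping.single \<delta> 1 \<in> ?L" by (simp add: mult_single \<delta>)
  qed
qed

lemma keys_nfold_sums:
  assumes "\<And>\<alpha>. \<alpha> \<in> A \<Longrightarrow> Poly_Mapping.keys \<alpha> \<subseteq> X" and "\<alpha> \<in> nfold_sums k A"
  shows "Poly_Mapping.keys (\<alpha> :: 'x \<Rightarrow>\<^sub>0 nat) \<subseteq> X"
  using assms(2)
proof (induction k arbitrary: \<alpha>)
  case (Suc k)
  then show ?case using assms(1) by (fastforce simp: keys_add_nat)
qed simp

lemma ideal_power_monomial_ideal:
  assumes "\<And>\<alpha>. \<alpha> \<in> A \<Longrightarrow> Poly_Mapping.keys \<alpha> \<subseteq> X"
  shows "ideal_power (poly_ring X) (monomial_ideal X A) k =
    (monomial_ideal X (nfold_sums k A) :: ('x, 'k::field) mpoly set)"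
proof (induction k)
  case 0
  have "multiples {0} = (UNIV :: ('x \<Rightarrow>\<^sub>0 nat) set)" by (auto simp: multiples_def)
  then show ?case
    by (simp add: ideal_power_def nat_pow_def ideals_set_def monomial_ideal_def)
next
  case (Suc k)
  have "ideal_power (poly_ring X) (monomial_ideal X A) (Suc k) =
      ideal_prod (poly_ring X) (ideal_power (poly_ring X) (monomial_ideal X A) k)
        (monomial_ideal X A :: ('x, 'k) mpoly set)"
    by (simp add: ideal_power_def nat_pow_def ideals_set_def)
  also have "\<dots> = monomial_ideal X (nfold_sums (Suc k) A)"
    unfolding Suc.IH using monomial_ideal_prod[OF keys_nfold_sums[of A X _ k] assms, where 'k = 'k] assms
    by simp
  finally show ?case .
qed

section \<open>Prime colon ideals and the v-number of a monomial ideal\<close>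

lemma unit_exp_multiples_iff:
  "\<alpha> \<in> multiples (unit_exp ` S) \<longleftrightarrow> Poly_Mapping.keys \<alpha> \<inter> S \<noteq> {}"
proof
  assume "Poly_Mapping.keys \<alpha> \<inter> S \<noteq> {}"
  then obtain a where a: "a \<in> S" "a \<in> Poly_Mapping.keys \<alpha>" by blast
  then have "\<alpha> = unit_exp a + (\<alpha> - unit_exp a)"
    by (intro poly_mapping_eqI) (auto simp: lookup_add lookup_minus lookup_unit_exp in_keys_iff)
  then show "\<alpha> \<in> multiples (unit_exp ` S)" using a multiplesI by (metis imageI)
qed (auto simp: multiples_def keys_add_nat)

text \<open>
  An ideal generated by variables is prime because dividing by it leaves the polynomial ring in the
  remaining variables, an integral domain. Here the residue class of \<open>h\<close> is represented by its
  part \<open>r h\<close> supported on the remaining variables. The linear order on the variables induces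
  one on the monomials, and products of leading terms do not vanish.
\<close>

lemma primeideal_variables:
  fixes X F :: "'x::linorder set"
  shows "primeideal (monomial_ideal X (unit_exp ` (X - F)) :: ('x, 'k::field) mpoly set) (poly_ring X)"
    (is "primeideal ?P _")
proof (rule primeidealI[OF monomial_ideal_is_ideal cring_poly_ring])
  note P = poly_ring_ideal[OF monomial_ideal_is_ideal[of X "unit_exp ` (X - F)"]]
  have "1 \<notin> ?P" by (auto simp: monomial_ideal_def unit_exp_multiples_iff)
  then show "carrier (poly_ring X) \<noteq> ?P" using poly_ring_closed(2) by blast
  fix f g :: "('x, 'k) mpoly"
  assume f: "f \<in> carrier (poly_ring X)" and g: "g \<in> carrier (poly_ring X)"
    and fg: "f \<otimes>\<^bsub>poly_ring X\<^esub> g \<in> ?P"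
  define r :: "('x, 'k) mpoly \<Rightarrow> ('x, 'k) mpoly" where
    "r h = (\<Sum>\<alpha>\<in>{\<alpha>\<in>Poly_Mapping.keys h. Poly_Mapping.keys \<alpha> \<subseteq> F}.
              Poly_Mapping.single \<alpha> (Poly_Mapping.lookup h \<alpha>))" for h
  have lookup_r: "Poly_Mapping.lookup (r h) \<alpha> =
      (if Poly_Mapping.keys \<alpha> \<subseteq> F then Poly_Mapping.lookup h \<alpha> else 0)" for h \<alpha>
    unfolding r_def by (auto simp: lookup_sum lookup_single when_def sum.delta in_keys_iff)
  have keys_r: "Poly_Mapping.keys (r h) = {\<alpha>\<in>Poly_Mapping.keys h. Poly_Mapping.keys \<alpha> \<subseteq> F}" for h
    by (simp add: set_eq_iff in_keys_iff[of _ "_ :: ('x, 'k) mpoly"] lookup_r)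
  have r_carrier: "r h \<in> carrier (poly_ring X)" if "h \<in> carrier (poly_ring X)" for h
    using that by (auto simp: carrier_poly_ring keys_r)
  have r_diff: "h - r h \<in> ?P" if "h \<in> carrier (poly_ring X)" for h
  proof -
    have "Poly_Mapping.keys (h - r h) = {\<alpha>\<in>Poly_Mapping.keys h. \<not> Poly_Mapping.keys \<alpha> \<subseteq> F}"
      by (simp add: set_eq_iff in_keys_iff[of _ "_ :: ('x, 'k) mpoly"] lookup_minus lookup_r)
    then show ?thesis
      using that by (auto simp: monomial_ideal_def carrier_poly_ring unit_exp_multiples_iff) blast
  qed
  (* Modulo P the product r f * r g equals f * g, so it lies in P; but none of its terms does. *)
  have "f * g - ((f - r f) * g + (g - r g) * r f) \<in> ?P"
    using P(4)[OF _ P(3)[OF P(5)[OF r_diff[OF f] g] P(5)[OF r_diff[OF g] r_carrier[OF f]]]] fg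
    by simp
  then have rfg: "r f * r g \<in> ?P" by (simp add: algebra_simps)
  have "Poly_Mapping.keys (r f * r g) = {}"
  proof (rule ccontr)
    assume "Poly_Mapping.keys (r f * r g) \<noteq> {}"
    then obtain \<gamma> where \<gamma>: "\<gamma> \<in> Poly_Mapping.keys (r f * r g)" by blast
    with keys_mult[of "r f" "r g"] obtain \<alpha> \<beta>
      where "\<alpha> \<in> Poly_Mapping.keys (r f)" "\<beta> \<in> Poly_Mapping.keys (r g)" "\<gamma> = \<alpha> + \<beta>" by blast
    then have "Poly_Mapping.keys \<gamma> \<subseteq> F" by (auto simp: keys_r keys_add_nat)
    moreover have "\<gamma> \<in> multiples (unit_exp ` (X - F))" using rfg \<gamma> by (auto simp: monomial_ideal_def)
    ultimately show False by (auto simp: unit_exp_multiples_iff)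
  qed
  then have "r f * r g = 0" by simp
  then have "r f = 0 \<or> r g = 0" by simp
  then show "f \<in> ?P \<or> g \<in> ?P" using r_diff[OF f] r_diff[OF g] by auto
qed

text \<open>
  Multiplication by a monomial is injective on monomials, so no terms cancel.
\<close>

lemma keys_mult_single:
  "Poly_Mapping.keys (f * Poly_Mapping.single \<alpha> 1) = (\<lambda>\<beta>. \<beta> + \<alpha>) ` Poly_Mapping.keys f"
  for f :: "('x, 'k::field) mpoly"
proof -
  have eq: "Poly_Mapping.lookup (f * Poly_Mapping.single \<alpha> 1) (\<beta> + \<alpha>) = Poly_Mapping.lookup f \<beta>" for \<beta>
  proof -
    have "f * Poly_Mapping.single \<alpha> 1 =
      (\<Sum>\<gamma>\<in>Poly_Mapping.keys f. Poly_Mapping.single (\<gamma> + \<alpha>) (Poly_Mapping.lookup f \<gamma>))"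
      by (subst (1) poly_mapping_sum_single[of f]) (simp add: sum_distrib_right mult_single)
    then show ?thesis
      by (simp add: lookup_sum lookup_single when_def sum.delta in_keys_iff)
  qed
  show ?thesis
  proof
    show "Poly_Mapping.keys (f * Poly_Mapping.single \<alpha> 1) \<subseteq> (\<lambda>\<beta>. \<beta> + \<alpha>) ` Poly_Mapping.keys f"
      using keys_mult[of f "Poly_Mapping.single \<alpha> 1"] by auto
    show "(\<lambda>\<beta>. \<beta> + \<alpha>) ` Poly_Mapping.keys f \<subseteq> Poly_Mapping.keys (f * Poly_Mapping.single \<alpha> 1)"
      by (auto simp: in_keys_iff eq)
  qed
qed

text \<open>
  A colon ideal of a monomial ideal by a monomial is again a monomial ideal, so it is determined by
  its monomials. The first condition puts the variables outside \<open>F\<close> into it, the second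
  keeps all monomials in the variables of \<open>F\<close> out.
\<close>

lemma colon_monomial:
  assumes "Poly_Mapping.keys \<alpha> \<subseteq> X"
    and inside: "\<And>a. a \<in> X - F \<Longrightarrow> \<alpha> + unit_exp a \<in> multiples A"
    and outside: "\<And>\<gamma>. Poly_Mapping.keys \<gamma> \<subseteq> F \<Longrightarrow> \<alpha> + \<gamma> \<notin> multiples A"
  shows "colon_ideal (poly_ring X) (monomial_ideal X A) (Poly_Mapping.single \<alpha> 1) =
    (monomial_ideal X (unit_exp ` (X - F)) :: ('x, 'k::field) mpoly set)"
proof -
  have iff: "\<gamma> + \<alpha> \<in> multiples A \<longleftrightarrow> \<gamma> \<in> multiples (unit_exp ` (X - F))"
    if "Poly_Mapping.keys \<gamma> \<subseteq> X" for \<gamma>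
  proof
    assume "\<gamma> + \<alpha> \<in> multiples A"
    with outside[of \<gamma>] that show "\<gamma> \<in> multiples (unit_exp ` (X - F))"
      by (auto simp: unit_exp_multiples_iff add.commute)
  next
    assume "\<gamma> \<in> multiples (unit_exp ` (X - F))"
    then obtain a \<delta> where "a \<in> X - F" "\<gamma> = unit_exp a + \<delta>" by (auto simp: multiples_def)
    then show "\<gamma> + \<alpha> \<in> multiples A"
      using multiples_add[OF inside, of a \<delta>] by (simp add: ac_simps)
  qed
  have x: "Poly_Mapping.single \<alpha> 1 \<in> carrier (poly_ring X :: ('x, 'k) mpoly ring)"
    using assms(1) by (simp add: carrier_poly_ring)
  have "f \<otimes>\<^bsub>poly_ring X\<^esub> Poly_Mapping.single \<alpha> 1 \<in> monomial_ideal X A \<longleftrightarrow>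
      Poly_Mapping.keys f \<subseteq> multiples (unit_exp ` (X - F))"
    if "f \<in> carrier (poly_ring X)" for f :: "('x, 'k) mpoly"
    using that poly_ring_closed(4)[OF that x] iff
    by (auto simp: monomial_ideal_def keys_mult_single carrier_poly_ring image_subset_iff)
  then show ?thesis unfolding colon_ideal_def by (subst monomial_ideal_def) blast
qed

text \<open>
  Under these conditions the colon ideal is generated by variables, so it is an associated prime.
\<close>

lemma v_number_le:
  fixes X :: "'x::linorder set"
  assumes "Poly_Mapping.keys \<alpha> \<subseteq> X"
    and "\<And>a. a \<in> X - F \<Longrightarrow> \<alpha> + unit_exp a \<in> multiples A"
    and "\<And>\<gamma>. Poly_Mapping.keys \<gamma> \<subseteq> F \<Longrightarrow> \<alpha> + \<gamma> \<notin> multiples A"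
  shows "v_number X (monomial_ideal X A :: ('x, 'k::field) mpoly set) \<le> enat (mon_degree \<alpha>)"
proof -
  let ?P = "monomial_ideal X (unit_exp ` (X - F)) :: ('x, 'k) mpoly set"
  note colon = colon_monomial[OF assms, where 'k = 'k]
  have f: "Poly_Mapping.single \<alpha> 1 \<in> (graded_component X (mon_degree \<alpha>) :: ('x, 'k) mpoly set)"
    using assms(1) by (simp add: graded_component_def carrier_poly_ring)
  then have "?P \<in> associated_primes (poly_ring X) (monomial_ideal X A)"
    using colon primeideal_variables[of X F] by (auto simp: associated_primes_def graded_component_def)
  then have "v_number X (monomial_ideal X A :: ('x, 'k) mpoly set) \<le> local_v_number X (monomial_ideal X A) ?P"
    unfolding v_number_def by (rule INF_lower)
  also have "\<dots> \<le> enat (mon_degree \<alpha>)"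
    unfolding local_v_number_def by (rule INF_lower) (use f colon in blast)
  finally show ?thesis .
qed

lemma one_notin_primeideal:
  assumes "primeideal P (poly_ring X)"
  shows "1 \<notin> (P :: ('x, 'k::field) mpoly set)"
  using primeideal.I_notcarr[OF assms] ideal.one_imp_carrier[OF primeideal.axioms(1)[OF assms]]
  by auto

text \<open>
  This reduces lower bounds to monomials: if \<open>f\<close> is not in the monomial ideal, neither is some term of
  it, whereas \<open>x\<^sub>a f\<close> being in the ideal forces \<open>x\<^sub>a\<close> times that term into it.
\<close>

lemma colon_monomial_ideal_term:
  fixes f :: "('x, 'k::field) mpoly"
  assumes f: "f \<in> carrier (poly_ring X)" and P: "primeideal (colon_ideal (poly_ring X) (monomial_ideal X A) f) (poly_ring X)"
  obtains \<alpha> where "\<alpha> \<in> Poly_Mapping.keys f" "\<alpha> \<notin> multiples A"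
    "\<And>a. pvar a \<in> colon_ideal (poly_ring X) (monomial_ideal X A) f \<Longrightarrow> \<alpha> + unit_exp a \<in> multiples A"
proof -
  let ?P = "colon_ideal (poly_ring X) (monomial_ideal X A) f"
  have "1 \<notin> ?P" by (rule one_notin_primeideal[OF P])
  then have "f \<notin> monomial_ideal X A"
    by (simp add: colon_ideal_def poly_ring_closed)
  then obtain \<alpha> where \<alpha>: "\<alpha> \<in> Poly_Mapping.keys f" "\<alpha> \<notin> multiples A"
    using f by (auto simp: monomial_ideal_def)
  moreover have "\<alpha> + unit_exp a \<in> multiples A" if "pvar a \<in> ?P" for a
  proof -
    have "f * Poly_Mapping.single (unit_exp a) 1 \<in> monomial_ideal X A"
      using that by (simp add: colon_ideal_def pvar_eq mult.commute)
    then show ?thesis using \<alpha> by (auto simp: monomial_ideal_def keys_mult_single)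
  qed
  ultimately show ?thesis using that by blast
qed

text \<open>
  The \<open>t\<close>-th power of a generator lies in the \<open>t\<close>-th power of the ideal, so a prime over the
  latter contains the generator.
\<close>

lemma nfold_sums_prime:
  assumes P: "primeideal P (poly_ring X)"
    and sub: "monomial_ideal X (nfold_sums t A) \<subseteq> (P :: ('x, 'k::field) mpoly set)"
    and A: "\<And>\<alpha>. \<alpha> \<in> A \<Longrightarrow> Poly_Mapping.keys \<alpha> \<subseteq> X"
    and \<alpha>: "\<alpha> \<in> A"
  shows "Poly_Mapping.single \<alpha> 1 \<in> P"
proof -
  have pow: "\<exists>\<beta>\<in>nfold_sums k A. Poly_Mapping.single \<beta> 1 = (Poly_Mapping.single \<alpha> 1 :: ('x, 'k) mpoly) ^ k" for k
  proof (induction k)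
    case (Suc k)
    then obtain \<beta> where "\<beta> \<in> nfold_sums k A"
      "Poly_Mapping.single \<beta> 1 = (Poly_Mapping.single \<alpha> 1 :: ('x, 'k) mpoly) ^ k" by blast
    then have "\<beta> + \<alpha> \<in> nfold_sums (Suc k) A"
      "Poly_Mapping.single (\<beta> + \<alpha>) 1 = (Poly_Mapping.single \<alpha> 1 :: ('x, 'k) mpoly) ^ Suc k"
      using \<alpha> by (auto simp: mult_single add.commute[of \<alpha>] simp flip: \<open>Poly_Mapping.single \<beta> 1 = _\<close>)
    then show ?case by blast
  qed simp
  have car: "(Poly_Mapping.single \<alpha> 1 :: ('x, 'k) mpoly) ^ k \<in> carrier (poly_ring X)" for k
  proof -
    obtain \<beta> where "\<beta> \<in> nfold_sums k A"
      "Poly_Mapping.single \<beta> 1 = (Poly_Mapping.single \<alpha> 1 :: ('x, 'k) mpoly) ^ k"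
      using pow by blast
    with keys_nfold_sums[OF A] show ?thesis
      by (metis carrier_poly_ring keys_single singletonD zero_neq_one)
  qed
  have "(Poly_Mapping.single \<alpha> 1 :: ('x, 'k) mpoly) ^ k \<in> P \<Longrightarrow> Poly_Mapping.single \<alpha> 1 \<in> P" for k
  proof (induction k)
    case 0
    then show ?case using one_notin_primeideal[OF P] by simp
  next
    case (Suc k)
    then show ?case using primeideal.I_prime[OF P _ car[of k], of "Poly_Mapping.single \<alpha> 1"] car[of 1] by auto
  qed
  moreover have "(Poly_Mapping.single \<alpha> 1 :: ('x, 'k) mpoly) ^ t \<in> P"
    using pow[of t] keys_nfold_sums[OF A] subset_multiples sub
    by (metis single_in_monomial_ideal subsetD)
  ultimately show ?thesis by blast
qed

text \<open>
  The combinatorial form of a lower bound for the v-number of a power of an ideal generated by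
  quadratic monomials. The set \<open>C\<close> consists of the variables in the associated prime, which
  form a vertex cover because the prime contains the ideal; \<open>\<alpha>\<close> is a term, outside the power, of a
  polynomial that realises the prime as a colon ideal.
\<close>

lemma enat_le_v_number:
  fixes X :: "'x set" and A :: "('x \<Rightarrow>\<^sub>0 nat) set"
  assumes A: "\<And>\<alpha>. \<alpha> \<in> A \<Longrightarrow> Poly_Mapping.keys \<alpha> \<subseteq> X"
    and bound: "\<And>C \<alpha>. \<lbrakk>C \<subseteq> X; \<And>a b. unit_exp a + unit_exp b \<in> A \<Longrightarrow> a \<in> C \<or> b \<in> C;
       Poly_Mapping.keys \<alpha> \<subseteq> X; \<alpha> \<notin> multiples (nfold_sums t A);
       \<And>a. a \<in> C \<Longrightarrow> \<alpha> + unit_exp a \<in> multiples (nfold_sums t A)\<rbrakk> \<Longrightarrow> d \<le> mon_degree \<alpha>"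
  shows "enat d \<le> v_number X (monomial_ideal X (nfold_sums t A) :: ('x, 'k::field) mpoly set)"
proof -
  let ?I = "monomial_ideal X (nfold_sums t A) :: ('x, 'k) mpoly set"
  have "d \<le> e" if P: "primeideal (colon_ideal (poly_ring X) ?I f) (poly_ring X)"
    and f: "f \<in> graded_component X e" for e and f :: "('x, 'k) mpoly"
  proof -
    let ?P = "colon_ideal (poly_ring X) ?I f"
    have fc: "f \<in> carrier (poly_ring X)" using f by (simp add: graded_component_def)
    have "?I \<subseteq> ?P"
      using poly_ring_ideal(1,5)[OF monomial_ideal_is_ideal[of X]] fc by (auto simp: colon_ideal_def)
    then have prime: "Poly_Mapping.single \<alpha> 1 \<in> ?P" if "\<alpha> \<in> A" for \<alpha>
      by (rule nfold_sums_prime[OF P _ A that])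
    define C where "C = {a \<in> X. pvar a \<in> ?P}"
    obtain \<alpha> where \<alpha>: "\<alpha> \<in> Poly_Mapping.keys f" "\<alpha> \<notin> multiples (nfold_sums t A)"
      "\<And>a. pvar a \<in> ?P \<Longrightarrow> \<alpha> + unit_exp a \<in> multiples (nfold_sums t A)"
      using colon_monomial_ideal_term[OF fc P] by blast
    have cover: "a \<in> C \<or> b \<in> C" if "unit_exp a + unit_exp b \<in> A" for a b
    proof -
      have X: "a \<in> X" "b \<in> X" using A[OF that] by (auto simp: keys_add_nat)
      then have "pvar a \<in> carrier (poly_ring X :: ('x, 'k) mpoly ring)"
        "pvar b \<in> carrier (poly_ring X :: ('x, 'k) mpoly ring)"
        by (auto simp: carrier_poly_ring pvar_eq)
      moreover have "pvar a * pvar b \<in> ?P" using prime[OF that] by (simp add: pvar_eq mult_single)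
      ultimately show ?thesis using primeideal.I_prime[OF P, of "pvar a" "pvar b"] X by (auto simp: C_def)
    qed
    have "d \<le> mon_degree \<alpha>"
      by (rule bound[of C]) (use \<alpha> cover fc in \<open>auto simp: C_def carrier_poly_ring\<close>)
    also have "mon_degree \<alpha> = e" using f \<alpha>(1) by (simp add: graded_component_def)
    finally show ?thesis .
  qed
  then show ?thesis
    unfolding v_number_def local_v_number_def associated_primes_def
    by (intro INF_greatest) auto
qed

section \<open>Monomials divisible by several generators\<close>

lemma nfold_sums_add:
  "\<lbrakk>\<alpha> \<in> nfold_sums j A; \<beta> \<in> nfold_sums k A\<rbrakk> \<Longrightarrow> \<alpha> + \<beta> \<in> nfold_sums (j + k) A"
proof (induction k arbitrary: \<beta>)
  case (Suc k)
  then obtain \<beta>' \<gamma> where "\<beta> = \<beta>' + \<gamma>" "\<alpha> + \<beta>' \<in> nfold_sums (j + k) A" "\<gamma> \<in> A" by auto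
  then show ?case by (auto simp flip: add.assoc)
qed simp

lemma nfold_sums_1: "\<alpha> \<in> A \<Longrightarrow> \<alpha> \<in> nfold_sums 1 A"
  by (simp add: numeral_eq_Suc)

lemma nfold_sums_sum:
  "\<lbrakk>finite S; \<And>i. i \<in> S \<Longrightarrow> f i \<in> A\<rbrakk> \<Longrightarrow> sum f S \<in> nfold_sums (card S) A"
proof (induction S rule: finite_induct)
  case (insert i S)
  then have "sum f S + f i \<in> nfold_sums (card S + 1) A"
    by (intro nfold_sums_add nfold_sums_1) auto
  then show ?case using insert by (simp add: add.commute)
qed simp

lemma nfold_sums_extract:
  "\<lbrakk>\<alpha> \<in> nfold_sums t A; a \<in> Poly_Mapping.keys \<alpha>\<rbrakk> \<Longrightarrow>
    \<exists>\<beta> \<gamma>. \<alpha> = \<beta> + \<gamma> \<and> \<gamma> \<in> A \<and> a \<in> Poly_Mapping.keys \<gamma> \<and> \<beta> \<in> nfold_sums (t - 1) A"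
  for \<alpha> :: "'x \<Rightarrow>\<^sub>0 nat"
proof (induction t arbitrary: \<alpha>)
  case (Suc t)
  then obtain \<beta> \<gamma> where \<beta>\<gamma>: "\<alpha> = \<beta> + \<gamma>" "\<beta> \<in> nfold_sums t A" "\<gamma> \<in> A" by auto
  show ?case
  proof (cases "a \<in> Poly_Mapping.keys \<gamma>")
    case True
    with \<beta>\<gamma> show ?thesis by auto
  next
    case False
    with Suc.prems \<beta>\<gamma> have a: "a \<in> Poly_Mapping.keys \<beta>" by (auto simp: keys_add_nat)
    from Suc.IH[OF \<beta>\<gamma>(2) a] obtain \<beta>' \<gamma>' where IH: "\<beta> = \<beta>' + \<gamma>'" "\<gamma>' \<in> A"
      "a \<in> Poly_Mapping.keys \<gamma>'" "\<beta>' \<in> nfold_sums (t - 1) A" by blast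
    have "t \<noteq> 0" using \<beta>\<gamma>(2) a by (cases t) auto
    then have "\<beta>' + \<gamma> \<in> nfold_sums t A"
      using nfold_sums_add[OF IH(4) nfold_sums_1[OF \<beta>\<gamma>(3)]] by simp
    then show ?thesis using IH \<beta>\<gamma>(1) by (metis add.assoc add.commute diff_Suc_1)
  qed
qed simp

text \<open>
  If multiplication by \<open>x\<^sub>a\<close> moves a monomial into the ideal power, then a factorization that
  witnesses this must use the new variable: otherwise it would already be available before.
\<close>

lemma new_variable_used:
  assumes new: "\<alpha> + unit_exp a \<in> multiples (nfold_sums t A)"
    and old: "\<alpha> \<notin> multiples (nfold_sums t A)"
  obtains \<beta> \<gamma> \<delta> where "\<alpha> + unit_exp a = \<beta> + \<gamma> + \<delta>" "\<gamma> \<in> A" "a \<in> Poly_Mapping.keys \<gamma>"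
    "\<beta> \<in> nfold_sums (t - 1) A"
proof -
  from new obtain \<epsilon> \<delta> where e: "\<alpha> + unit_exp a = \<epsilon> + \<delta>" "\<epsilon> \<in> nfold_sums t A"
    by (auto simp: multiples_def)
  have "a \<in> Poly_Mapping.keys \<epsilon>"
  proof (rule ccontr)
    assume a: "a \<notin> Poly_Mapping.keys \<epsilon>"
    moreover have "a \<in> Poly_Mapping.keys (\<epsilon> + \<delta>)" using e(1)[symmetric] by (simp add: keys_add_nat)
    ultimately have "a \<in> Poly_Mapping.keys \<delta>" by (simp add: keys_add_nat)
    then have "\<delta> \<in> multiples (unit_exp ` {a})" by (subst unit_exp_multiples_iff) auto
    then obtain \<delta>' where "\<delta> = unit_exp a + \<delta>'" by (auto simp: multiples_def)
    with e(1) have "\<alpha> + unit_exp a = (\<epsilon> + \<delta>') + unit_exp a" by (simp add: ac_simps)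
    then have "\<alpha> = \<epsilon> + \<delta>'" by (rule add_right_imp_eq)
    with e(2) old show False by (auto simp: multiplesI)
  qed
  from nfold_sums_extract[OF e(2) this] e(1) that show ?thesis by blast
qed

text \<open>
  Counting degrees only in a well-chosen set \<open>N\<close> of variables bounds the number of generators whose
  product divides a given monomial.
\<close>

definition weight :: "'x set \<Rightarrow> ('x \<Rightarrow>\<^sub>0 nat) \<Rightarrow> nat" where
  "weight N \<alpha> = (\<Sum>x\<in>Poly_Mapping.keys \<alpha> \<inter> N. Poly_Mapping.lookup \<alpha> x)"

lemma mon_degree_weight: "mon_degree \<alpha> = weight UNIV \<alpha>"
  by (simp add: mon_degree_def weight_def)

lemma weight_superset:
  "finite S \<Longrightarrow> Poly_Mapping.keys \<alpha> \<subseteq> S \<Longrightarrow> weight N \<alpha> = (\<Sum>x\<in>S \<inter> N. Poly_Mapping.lookup \<alpha> x)"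
  unfolding weight_def by (rule sum.mono_neutral_left) (auto simp: in_keys_iff)

lemma weight_add: "weight N (\<alpha> + \<beta>) = weight N \<alpha> + weight N \<beta>"
proof -
  let ?S = "Poly_Mapping.keys \<alpha> \<union> Poly_Mapping.keys \<beta>"
  show ?thesis
    by (simp add: weight_superset[of ?S] keys_add_nat lookup_add sum.distrib)
qed

lemma weight_unit_exp: "weight N (unit_exp a) = (if a \<in> N then 1 else 0)"
  by (simp add: weight_def lookup_unit_exp)

lemma weight_zero: "weight N 0 = 0"
  by (simp add: weight_def)

lemma weight_sum: "weight N (sum f S) = (\<Sum>i\<in>S. weight N (f i))"
  by (induction S rule: infinite_finite_induct) (simp_all add: weight_add weight_zero)

text \<open>
  Each of the \<open>t\<close> generators occupies at least \<open>c\<close> of the degree in \<open>N\<close>. Only generators in the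
  variables of \<open>\<alpha>\<close> matter, which allows for \<open>c = 2\<close> when all edges inside a monomial avoid
  the complement of \<open>N\<close>.
\<close>

lemma weight_multiples_nfold_sums:
  assumes "\<alpha> \<in> multiples (nfold_sums t A)"
    and "\<And>\<gamma>. \<gamma> \<in> A \<Longrightarrow> Poly_Mapping.keys \<gamma> \<subseteq> Poly_Mapping.keys \<alpha> \<Longrightarrow> c \<le> weight N \<gamma>"
  shows "c * t \<le> weight N \<alpha>"
proof -
  from assms(1) obtain \<beta> \<delta> where \<beta>: "\<alpha> = \<beta> + \<delta>" "\<beta> \<in> nfold_sums t A" by (auto simp: multiples_def)
  have "c * k \<le> weight N \<beta>" if "\<beta> \<in> nfold_sums k A" "Poly_Mapping.keys \<beta> \<subseteq> Poly_Mapping.keys \<alpha>" for k \<beta>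
    using that
  proof (induction k arbitrary: \<beta>)
    case (Suc k)
    then obtain \<beta>' \<gamma> where "\<beta> = \<beta>' + \<gamma>" "\<beta>' \<in> nfold_sums k A" "\<gamma> \<in> A" by auto
    with Suc assms(2)[of \<gamma>] show ?case by (force simp: keys_add_nat weight_add)
  qed simp
  from this[OF \<beta>(2)] show ?thesis by (simp add: \<beta>(1) keys_add_nat weight_add trans_le_add1)
qed

section \<open>The Stanley--Reisner ideal of a chessboard complex\<close>

text \<open>
  The minimal nonfaces of the chessboard complex are the pairs of squares in a common row or column,
  that is, the edges of the rook's graph. These are the exponents of the corresponding quadratic
  monomials.
\<close>

definition rook_edges :: "nat \<Rightarrow> nat \<Rightarrow> ((nat \<times> nat) \<Rightarrow>\<^sub>0 nat) set" where
  "rook_edges m n = {unit_exp a + unit_exp b | a b. a \<in> chessboard m n \<and> b \<in> chessboard m n \<and>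
     a \<noteq> b \<and> (fst a = fst b \<or> snd a = snd b)}"

lemma finite_chessboard: "finite (chessboard m n)"
  by (simp add: chessboard_def)

lemma rook_edgesI:
  "\<lbrakk>a \<in> chessboard m n; b \<in> chessboard m n; a \<noteq> b; fst a = fst b \<or> snd a = snd b\<rbrakk> \<Longrightarrow>
    unit_exp a + unit_exp b \<in> rook_edges m n"
  unfolding rook_edges_def by blast

lemma keys_rook_edges: "\<alpha> \<in> rook_edges m n \<Longrightarrow> Poly_Mapping.keys \<alpha> \<subseteq> chessboard m n"
  by (auto simp: rook_edges_def keys_add_nat)

lemma prod_pvar:
  "finite F \<Longrightarrow> (\<Prod>x\<in>F. pvar x) = (Poly_Mapping.single (\<Sum>x\<in>F. unit_exp x) 1 :: ('x, 'k::field) mpoly)"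
  by (induction F rule: finite_induct) (simp_all add: pvar_eq mult_single)

lemma keys_sum_nat:
  "finite F \<Longrightarrow> Poly_Mapping.keys (sum f F :: 'x \<Rightarrow>\<^sub>0 nat) = (\<Union>x\<in>F. Poly_Mapping.keys (f x))"
  by (induction F rule: finite_induct) (simp_all add: keys_add_nat)

text \<open>
  Every nonface contains a pair of attacking squares, and each such pair is itself a nonface.
\<close>

lemma stanley_reisner_chessboard:
  "stanley_reisner_ideal (chessboard m n) (chessboard_complex m n) =
    (monomial_ideal (chessboard m n) (rook_edges m n) :: (nat \<times> nat, 'k::field) mpoly set)"
    (is "?I = ?J")
proof
  let ?V = "chessboard m n"
  let ?S = "{\<Prod>x\<in>F. pvar x | F. F \<subseteq> ?V \<and> F \<notin> chessboard_complex m n} :: (nat \<times> nat, 'k) mpoly set"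
  note R = cring.axioms(1)[OF cring_poly_ring[of ?V]]
  have fin: "finite F" if "F \<subseteq> ?V" for F using that finite_chessboard finite_subset by blast
  have sub: "?S \<subseteq> carrier (poly_ring ?V)"
    using fin by (force simp: prod_pvar carrier_poly_ring keys_sum_nat)
  have "?S \<subseteq> ?J"
  proof
    fix p assume "p \<in> ?S"
    then obtain F where F: "F \<subseteq> ?V" "F \<notin> chessboard_complex m n" and p: "p = (\<Prod>x\<in>F. pvar x)" by blast
    then obtain a b where ab: "a \<in> F" "b \<in> F" "a \<noteq> b" "fst a = fst b \<or> snd a = snd b"
      by (auto simp: chessboard_complex_def)
    have "(\<Sum>x\<in>F. unit_exp x) = (unit_exp a + unit_exp b) + (\<Sum>x\<in>F - {a} - {b}. unit_exp x)"
      using ab fin[OF F(1)] by (simp add: sum.remove[of F a] sum.remove[of "F - {a}" b] add.assoc)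
    moreover have "unit_exp a + unit_exp b \<in> rook_edges m n"
      using ab F by (intro rook_edgesI) auto
    ultimately have "(\<Sum>x\<in>F. unit_exp x) \<in> multiples (rook_edges m n)"
      using multiplesI by metis
    then show "p \<in> ?J"
      using fin[OF F(1)] F(1) by (auto simp: p prod_pvar single_in_monomial_ideal keys_sum_nat)
  qed
  then show "?I \<subseteq> ?J"
    unfolding stanley_reisner_ideal_def
    by (rule ring.genideal_minimal[OF R monomial_ideal_is_ideal])
  show "?J \<subseteq> ?I"
  proof (rule monomial_ideal_least)
    show "ideal ?I (poly_ring ?V)"
      unfolding stanley_reisner_ideal_def by (rule ring.genideal_ideal[OF R sub])
    fix \<alpha> assume "\<alpha> \<in> rook_edges m n"
    then obtain a b where ab: "\<alpha> = unit_exp a + unit_exp b" "a \<in> ?V" "b \<in> ?V" "a \<noteq> b"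
      "fst a = fst b \<or> snd a = snd b"
      by (auto simp: rook_edges_def)
    then have "{a, b} \<subseteq> ?V \<and> {a, b} \<notin> chessboard_complex m n"
      by (auto simp: chessboard_complex_def)
    then have "(\<Prod>x\<in>{a, b}. pvar x) \<in> ?S" by blast
    then show "Poly_Mapping.single \<alpha> 1 \<in> ?I"
      unfolding stanley_reisner_ideal_def
      using ring.genideal_self[OF R sub] ab prod_pvar[of "{a, b}", where 'k = 'k] by auto
  qed
qed

section \<open>The lower bound\<close>

text \<open>
  The bound \<open>2 * t - 1\<close> holds because the generators of the \<open>t\<close>-th power have degree \<open>2 * t\<close>.

  For the bound \<open>m\<close>, suppose that \<open>\<alpha>\<close> has degree below \<open>m\<close>; then some row and some column are free
  of squares of \<open>\<alpha>\<close>. A square in a free row and a free column attacks no square of \<open>\<alpha>\<close>, so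
  multiplying by it creates no new edge and it cannot lie in \<open>C\<close>. Since \<open>C\<close> is a vertex cover, such
  squares do not attack each other, and there is exactly one free row and one free column. Hence
  the squares of \<open>\<alpha>\<close> are \<open>m - 1\<close> non-attacking rooks. But then a new square
  can only give edges that contain it, so at most one at a time, while \<open>t \<ge> 2\<close> edges are required.
\<close>

lemma rook_lower_bound:
  assumes mn: "1 \<le> m" "m \<le> n" "2 \<le> n" and t: "2 \<le> t"
    and C: "C \<subseteq> chessboard m n"
    and cover: "\<And>a b. unit_exp a + unit_exp b \<in> rook_edges m n \<Longrightarrow> a \<in> C \<or> b \<in> C"
    and keys: "Poly_Mapping.keys \<alpha> \<subseteq> chessboard m n"
    and old: "\<alpha> \<notin> multiples (nfold_sums t (rook_edges m n))"
    and new: "\<And>a. a \<in> C \<Longrightarrow> \<alpha> + unit_exp a \<in> multiples (nfold_sums t (rook_edges m n))"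
  shows "max m (2 * t - 1) \<le> mon_degree \<alpha>"
proof -
  have "unit_exp (1, 1) + unit_exp (1, 2) \<in> rook_edges m n"
    using mn by (intro rook_edgesI) (auto simp: chessboard_def)
  then obtain a0 where a0: "a0 \<in> C" using cover by blast
  have "2 * t \<le> weight UNIV (\<alpha> + unit_exp a0)"
    by (rule weight_multiples_nfold_sums[OF new[OF a0]])
      (auto simp: rook_edges_def weight_add weight_unit_exp)
  then have deg: "2 * t - 1 \<le> mon_degree \<alpha>"
    by (simp add: mon_degree_weight weight_add weight_unit_exp)
  have neighbour: "\<exists>b \<beta> \<delta>. b \<noteq> a \<and> (fst a = fst b \<or> snd a = snd b) \<and> \<alpha> = \<beta> + unit_exp b + \<delta> \<and>
      \<beta> \<in> nfold_sums (t - 1) (rook_edges m n)" if "a \<in> C" for a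
  proof -
    obtain \<beta> \<gamma> \<delta> where *: "\<alpha> + unit_exp a = \<beta> + \<gamma> + \<delta>" "\<gamma> \<in> rook_edges m n"
      "a \<in> Poly_Mapping.keys \<gamma>" "\<beta> \<in> nfold_sums (t - 1) (rook_edges m n)"
      using new_variable_used[OF new[OF \<open>a \<in> C\<close>] old] by blast
    obtain b where b: "\<gamma> = unit_exp b + unit_exp a" "b \<noteq> a" "fst a = fst b \<or> snd a = snd b"
    proof -
      from *(2) obtain x y where xy: "\<gamma> = unit_exp x + unit_exp y" "x \<noteq> y" "fst x = fst y \<or> snd x = snd y"
        unfolding rook_edges_def by blast
      with *(3) consider "a = x" | "a = y" by (auto simp: keys_add_nat)
      then show ?thesis using that[of x] that[of y] xy by cases (auto simp: add.commute)
    qed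
    have "\<alpha> + unit_exp a = (\<beta> + unit_exp b + \<delta>) + unit_exp a" unfolding *(1) b(1) by (simp add: ac_simps)
    then have "\<alpha> = \<beta> + unit_exp b + \<delta>" by (rule add_right_imp_eq)
    with b *(4) show ?thesis by blast
  qed
  let ?K = "Poly_Mapping.keys \<alpha>"
  have card_le: "card ?K \<le> mon_degree \<alpha>"
    unfolding mon_degree_def card_eq_sum by (rule sum_mono) (simp add: Suc_le_eq in_keys_iff)
  have "m \<le> mon_degree \<alpha>"
  proof (rule ccontr)
    assume "\<not> m \<le> mon_degree \<alpha>"
    with card_le have K: "card ?K \<le> m - 1" by simp
    (* R and S are the rows and the columns without squares of \<alpha>. *)
    define R where "R = {1..m} - fst ` ?K"
    define S where "S = {1..n} - snd ` ?K"
    have cR: "m - card (fst ` ?K) \<le> card R" and cS: "n - card (snd ` ?K) \<le> card S"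
      unfolding R_def S_def using diff_card_le_card_Diff[of "fst ` ?K" "{1..m}"]
        diff_card_le_card_Diff[of "snd ` ?K" "{1..n}"] by simp_all
    have ci: "card (fst ` ?K) \<le> card ?K" "card (snd ` ?K) \<le> card ?K"
      by (simp_all add: card_image_le)
    have free: "(r, c) \<notin> C" if "r \<in> R" "c \<in> S" for r c
    proof
      assume "(r, c) \<in> C"
      from neighbour[OF this] obtain b \<beta> \<delta>
        where "\<alpha> = \<beta> + unit_exp b + \<delta>" "fst b = r \<or> snd b = c" by force
      moreover from this have "b \<in> ?K" by (simp add: keys_add_nat)
      ultimately show False using that by (auto simp: R_def S_def)
    qed
    have RS: "R \<subseteq> {1..m}" "S \<subseteq> {1..n}" "finite R" "finite S" by (auto simp: R_def S_def)
    have indep: "a = b" if "a \<in> R \<times> S" "b \<in> R \<times> S" "fst a = fst b \<or> snd a = snd b" for a b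
    proof (rule ccontr)
      assume "a \<noteq> b"
      have "R \<times> S \<subseteq> chessboard m n" using RS by (auto simp: chessboard_def)
      then have "unit_exp a + unit_exp b \<in> rook_edges m n"
        using that \<open>a \<noteq> b\<close> by (intro rook_edgesI) auto
      then have "a \<in> C \<or> b \<in> C" by (rule cover)
      moreover have "a \<notin> C" "b \<notin> C" using that(1,2) free by (cases a; cases b; blast)+
      ultimately show False by blast
    qed
    have "card R > 0" using cR ci(1) K mn by linarith
    moreover have "card S > 0" using cS ci(2) K mn by linarith
    ultimately obtain r c where rc: "r \<in> R" "c \<in> S" unfolding card_gt_0_iff by blast
    have "R \<subseteq> {r}"
    proof
      fix r' assume "r' \<in> R"
      then show "r' \<in> {r}" using indep[of "(r, c)" "(r', c)"] rc by simp
    qed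
    then have "card R \<le> 1" using card_mono[of "{r}" R] by simp
    have "S \<subseteq> {c}"
    proof
      fix c' assume "c' \<in> S"
      then show "c' \<in> {c}" using indep[of "(r, c)" "(r, c')"] rc by simp
    qed
    then have "card S \<le> 1" using card_mono[of "{c}" S] by simp
    have "card (fst ` ?K) = card ?K" using \<open>card R \<le> 1\<close> cR ci(1) K mn by linarith
    moreover have "card (snd ` ?K) = card ?K" using \<open>card S \<le> 1\<close> cS ci(2) K mn by linarith
    ultimately have inj: "inj_on fst ?K" "inj_on snd ?K" by (simp_all add: eq_card_imp_inj_on)
    (* Besides the edge through a0, the monomial \<alpha> + a0 contains t - 1 > 0 edges inside \<alpha>. *)
    obtain b \<beta> \<delta> where \<alpha>: "\<alpha> = \<beta> + unit_exp b + \<delta>" "\<beta> \<in> nfold_sums (t - 1) (rook_edges m n)"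
      using neighbour[OF a0] by blast
    obtain t' where t': "t - 1 = Suc t'" using t by (cases "t - 1") auto
    with \<alpha>(2) obtain \<beta>' \<gamma> where "\<beta> = \<beta>' + \<gamma>" "\<gamma> \<in> rook_edges m n" by auto
    then have "\<gamma> \<in> rook_edges m n" "Poly_Mapping.keys \<gamma> \<subseteq> ?K" by (auto simp: \<alpha>(1) keys_add_nat)
    then obtain x y where "x \<in> ?K" "y \<in> ?K" "x \<noteq> y" "fst x = fst y \<or> snd x = snd y"
      by (auto simp: rook_edges_def keys_add_nat)
    then show False using inj by (auto dest: inj_onD)
  qed
  with deg show ?thesis by simp
qed

section \<open>Monomials that attain the bound\<close>

text \<open>
  The witness is a star with the diagonal as the face \<open>F\<close>: let \<open>y\<^sub>i = (i, i)\<close> for \<open>1 \<le> i \<le> m\<close> and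
  \<open>z\<^sub>i = (1, i)\<close> for \<open>2 \<le> i \<le> m\<close>, and take the product of all \<open>y\<^sub>i\<close> and \<open>z\<^sub>i\<close>, together with
  \<open>t - m\<close> copies of the edge \<open>(1, 1), (1, 2)\<close>. Every edge contains a square off the diagonal, and the
  degree off the diagonal is only \<open>t - 1\<close>; this stays so after multiplication by diagonal squares.
  On the other hand the tree with vertices \<open>y\<^sub>i\<close> and with \<open>z\<^sub>i\<close> as the edge from \<open>y\<^sub>1\<close> to
  \<open>y\<^sub>i\<close> leaves any prescribed vertex \<open>y\<^sub>r\<close> free when the \<open>z\<^sub>i\<close> are matched with the other
  vertices, and a further square in row \<open>r\<close> off the diagonal is then matched with \<open>y\<^sub>r\<close>.
\<close>

lemma v_number_rook_le_of_many_factors: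
  assumes mn: "1 \<le> m" "m \<le> n" "2 \<le> n" and t: "m \<le> t"
  shows "v_number (chessboard m n)
      (monomial_ideal (chessboard m n) (nfold_sums t (rook_edges m n)) :: (nat \<times> nat, 'k::field) mpoly set)
    \<le> enat (2 * t - 1)"
proof -
  let ?E = "rook_edges m n"
  define F where "F = (\<lambda>i. (i, i)) ` {1..m}"
  define p where "p = (\<Sum>j<t - m. unit_exp (1::nat, 1::nat) + unit_exp (1, 2))"
  define \<alpha> where "\<alpha> = (\<Sum>i=1..m. unit_exp (i, i)) + (\<Sum>i=2..m. unit_exp (1, i)) + p"
  have V: "(i, j) \<in> chessboard m n" if "1 \<le> i" "i \<le> m" "1 \<le> j" "j \<le> n" for i j
    using that by (simp add: chessboard_def)
  have p: "p \<in> nfold_sums (t - m) ?E"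
  proof -
    have "unit_exp (1, 1) + unit_exp (1, 2) \<in> ?E" using mn by (intro rook_edgesI V) auto
    then show ?thesis
      unfolding p_def using nfold_sums_sum[of "{..<t - m}" "\<lambda>_. unit_exp (1, 1) + unit_exp (1, 2)" ?E]
      by simp
  qed
  have pairs: "(\<Sum>i\<in>S. unit_exp (i, i) + unit_exp (1, i)) \<in> nfold_sums (card S) ?E"
    if "S \<subseteq> {2..m}" for S
  proof (rule nfold_sums_sum)
    show "finite S" using that finite_subset by blast
    show "unit_exp (i, i) + unit_exp (1, i) \<in> ?E" if "i \<in> S" for i
      using that \<open>S \<subseteq> {2..m}\<close> mn by (intro rook_edgesI V) auto
  qed
  have keys: "Poly_Mapping.keys \<alpha> \<subseteq> chessboard m n"
    using mn by (auto simp: \<alpha>_def p_def keys_add_nat keys_sum_nat chessboard_def)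
  have inside: "\<alpha> + unit_exp a \<in> multiples (nfold_sums t ?E)" if a: "a \<in> chessboard m n - F" for a
  proof -
    obtain r c where rc: "a = (r, c)" by fastforce
    have rc': "1 \<le> r" "r \<le> m" "1 \<le> c" "c \<le> n" "c \<noteq> r" using a by (auto simp: chessboard_def F_def rc)
    then have edge: "unit_exp (r, r) + unit_exp a \<in> ?E"
      using mn by (auto simp: rc intro!: rook_edgesI V)
    have diag: "(\<Sum>i=1..m. unit_exp (i, i)) = unit_exp (1::nat, 1::nat) + (\<Sum>i=2..m. unit_exp (i, i))"
      using mn by (simp add: sum.atLeast_Suc_atMost numeral_2_eq_2)
    have "\<alpha> + unit_exp a \<in> nfold_sums t ?E"
    proof (cases "r = 1")
      case True
      have "(\<Sum>i=2..m. unit_exp (i, i) + unit_exp (1, i)) + p + (unit_exp (r, r) + unit_exp a)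
          \<in> nfold_sums (card {2..m} + (t - m) + 1) ?E"
        by (intro nfold_sums_add pairs p nfold_sums_1 edge) simp
      moreover have "card {2..m} + (t - m) + 1 = t" using mn t by simp
      moreover have "\<alpha> + unit_exp a =
          (\<Sum>i=2..m. unit_exp (i, i) + unit_exp (1, i)) + p + (unit_exp (r, r) + unit_exp a)"
        unfolding \<alpha>_def diag sum.distrib True by (simp only: ac_simps)
      ultimately show ?thesis by (simp only:)
    next
      case False
      then have r: "r \<in> {2..m}" using rc' by auto
      have edge': "unit_exp (1, 1) + unit_exp (1, r) \<in> ?E"
        using r mn by (intro rook_edgesI V) auto
      have "(\<Sum>i\<in>{2..m} - {r}. unit_exp (i, i) + unit_exp (1, i)) + p
            + (unit_exp (1, 1) + unit_exp (1, r)) + (unit_exp (r, r) + unit_exp a)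
          \<in> nfold_sums (card ({2..m} - {r}) + (t - m) + 1 + 1) ?E"
        by (intro nfold_sums_add pairs p nfold_sums_1 edge edge') auto
      moreover have "card ({2..m} - {r}) + (t - m) + 1 + 1 = t" using r t by simp arith
      moreover have "\<alpha> + unit_exp a = (\<Sum>i\<in>{2..m} - {r}. unit_exp (i, i) + unit_exp (1, i)) + p
            + (unit_exp (1, 1) + unit_exp (1, r)) + (unit_exp (r, r) + unit_exp a)"
        unfolding \<alpha>_def diag sum.distrib sum.remove[OF finite_atLeastAtMost r]
        by (simp only: ac_simps)
      ultimately show ?thesis by (simp only:)
    qed
    then show ?thesis by (rule subset_multiples)
  qed
  have outside: "\<alpha> + \<gamma> \<notin> multiples (nfold_sums t ?E)" if \<gamma>: "Poly_Mapping.keys \<gamma> \<subseteq> F" for \<gamma>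
  proof
    assume "\<alpha> + \<gamma> \<in> multiples (nfold_sums t ?E)"
    then have "1 * t \<le> weight (- F) (\<alpha> + \<gamma>)"
      by (rule weight_multiples_nfold_sums)
        (auto simp: rook_edges_def weight_add weight_unit_exp F_def)
    moreover have "weight (- F) \<gamma> = 0"
    proof -
      have "Poly_Mapping.keys \<gamma> \<inter> - F = {}" using \<gamma> by blast
      then show ?thesis by (simp add: weight_def)
    qed
    moreover have "weight (- F) (\<Sum>i=1..m. unit_exp (i, i)) = 0"
      by (simp add: weight_sum weight_unit_exp F_def)
    moreover have "weight (- F) (\<Sum>i=2..m. unit_exp (1, i)) \<le> m - 1"
      using sum_mono[of "{2..m}" "\<lambda>i. weight (- F) (unit_exp (1, i))" "\<lambda>_. 1"]
      by (simp add: weight_sum weight_unit_exp)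
    moreover have "weight (- F) p \<le> t - m"
    proof -
      have "(1, 1) \<in> F" using mn by (auto simp: F_def)
      then show ?thesis
        using sum_mono[of "{..<t - m}" "\<lambda>i. weight (- F) (unit_exp (1, 1) + unit_exp (1, 2))" "\<lambda>_. 1"]
        by (simp add: p_def weight_sum weight_unit_exp weight_add)
    qed
    ultimately show False using mn t by (simp add: \<alpha>_def weight_add)
  qed
  have "mon_degree \<alpha> = 2 * t - 1"
    using mn t by (simp add: mon_degree_weight \<alpha>_def p_def weight_add weight_sum weight_unit_exp)
  with v_number_le[where F = F, OF keys inside outside, where 'k = 'k] show ?thesis by simp
qed

text \<open>
  The squares of a column attack each other pairwise, so an even number of them can be paired off
  arbitrarily.
\<close>

lemma column_clique:
  assumes "finite S" "card S = 2 * k" "S \<subseteq> {1..m}" "1 \<le> n"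
  shows "(\<Sum>i\<in>S. unit_exp (i, 1)) \<in> nfold_sums k (rook_edges m n)"
  using assms(1-3)
proof (induction k arbitrary: S)
  case (Suc k)
  then obtain x where x: "x \<in> S" by fastforce
  with Suc have "card (S - {x}) = Suc (2 * k)" by simp
  then obtain y where y: "y \<in> S - {x}" by (metis card.empty ex_in_conv nat.distinct(1))
  have "(\<Sum>i\<in>S - {x} - {y}. unit_exp (i, 1)) + (unit_exp (x, 1) + unit_exp (y, 1))
      \<in> nfold_sums (k + 1) (rook_edges m n)"
    using Suc x y assms(4)
    by (intro nfold_sums_add nfold_sums_1 Suc.IH rook_edgesI) (auto simp: chessboard_def)
  moreover have "(\<Sum>i\<in>S. unit_exp (i, 1::nat)) =
      (\<Sum>i\<in>S - {x} - {y}. unit_exp (i, 1)) + (unit_exp (x, 1) + unit_exp (y, 1))"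
    using Suc.prems(1) x y by (simp add: sum.remove[of S x] sum.remove[of "S - {x}" y] ac_simps)
  ultimately show ?case by simp
qed simp

text \<open>
  The product of the first \<open>s\<close> squares of the first column, with \<open>(1, 1)\<close> repeated to reach degree
  \<open>2 * t - 1\<close>, behaves like an odd cycle: after the removal of any one square the rest falls into
  \<open>t - 1\<close> edges. The condition \<open>t < s\<close> says that \<open>(1, 1)\<close> is repeated seldom enough to give
  each additional copy a partner other than \<open>(1, 1)\<close>.
\<close>

lemma column_minus_square:
  assumes s: "t < s" "s \<le> 2 * t - 1" "s \<le> m" and n: "1 \<le> n" and r: "r \<in> {1..s}"
  shows "(\<Sum>i\<in>{1..s} - {r}. unit_exp (i, 1)) + (\<Sum>j<2 * t - 1 - s. unit_exp (1, 1))
    \<in> nfold_sums (t - 1) (rook_edges m n)"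
proof -
  let ?p = "2 * t - 1 - s"
  (* T collects the partners of the additional copies of (1, 1). *)
  have "?p \<le> card ({2..s} - {r})" using s r by (cases "r \<in> {2..s}") auto
  then obtain T where T: "T \<subseteq> {2..s} - {r}" "card T = ?p" "finite T"
    by (rule obtain_subset_with_card_n)
  have const: "(\<Sum>j<?p. unit_exp (1::nat, 1::nat)) = (\<Sum>j\<in>T. unit_exp (1, 1))"
  proof -
    obtain h where "bij_betw h T {..<?p}"
      using finite_same_card_bij[of T "{..<?p}"] T by auto
    from sum.reindex_bij_betw[OF this, of "\<lambda>_. unit_exp (1::nat, 1::nat)"] show ?thesis by simp
  qed
  let ?U = "{1..s} - {r} - T"
  have sub: "T \<subseteq> {1..s} - {r}" using T(1) by auto
  have cU: "card ?U = 2 * (s - t)"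
    using T sub s r by (simp add: card_Diff_subset)
  have "(\<Sum>i\<in>T. unit_exp (i, 1) + unit_exp (1, 1)) + (\<Sum>i\<in>?U. unit_exp (i, 1))
      \<in> nfold_sums (card T + (s - t)) (rook_edges m n)"
    using T s n r
    by (intro nfold_sums_add nfold_sums_sum column_clique cU rook_edgesI) (auto simp: chessboard_def)
  moreover have "card T + (s - t) = t - 1" using T(2) s by simp
  moreover have "(\<Sum>i\<in>{1..s} - {r}. unit_exp (i, 1)) =
      (\<Sum>i\<in>?U. unit_exp (i, 1)) + (\<Sum>i\<in>T. unit_exp (i, 1::nat))"
    by (rule sum.subset_diff[OF sub]) simp
  ultimately show ?thesis unfolding const by (simp add: sum.distrib ac_simps)
qed

text \<open>
  The witness combines an odd clique of degree \<open>2 * t - 1\<close> in the first column with the diagonal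
  squares \<open>F\<close> in the rows that the clique does not meet. No square of the face \<open>F\<close> attacks a square of the
  clique or of \<open>F\<close>, so all edges lie in the clique, where there is room for at most \<open>t - 1\<close> of them, also
  after multiplication by squares of \<open>F\<close>. Since every row contains a square of the
  witness, any square \<open>a\<close> outside \<open>F\<close> attacks some square of it. If that square is in the
  clique, the rest of the clique splits into \<open>t - 1\<close> edges; if it is in \<open>F\<close>, the
  clique without \<open>(1, 1)\<close> provides them.
\<close>

lemma v_number_rook_le_of_few_factors:
  assumes t: "2 \<le> t" "t < m" and mn: "m \<le> n"
  shows "v_number (chessboard m n)
      (monomial_ideal (chessboard m n) (nfold_sums t (rook_edges m n)) :: (nat \<times> nat, 'k::field) mpoly set)
    \<le> enat (max m (2 * t - 1))"
proof -
  let ?E = "rook_edges m n"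
  define s where "s = min m (2 * t - 1)"
  have s: "t < s" "s \<le> 2 * t - 1" "s \<le> m" "2 \<le> s" using t by (auto simp: s_def)
  define F where "F = (\<lambda>i. (i, i)) ` {s<..m}"
  define q where "q = (\<Sum>j<2 * t - 1 - s. unit_exp (1::nat, 1::nat))"
  define \<alpha> where "\<alpha> = (\<Sum>i=1..s. unit_exp (i, 1)) + q + (\<Sum>i\<in>{s<..m}. unit_exp (i, i))"
  have column: "(\<Sum>i\<in>{1..s} - {r}. unit_exp (i, 1)) + q \<in> nfold_sums (t - 1) ?E" if "r \<in> {1..s}" for r
    unfolding q_def using column_minus_square[of t s m n r] s mn that by simp
  have keys_\<alpha>: "Poly_Mapping.keys \<alpha> \<subseteq> (\<lambda>i. (i, 1)) ` {1..s} \<union> F"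
    using s by (auto simp: \<alpha>_def q_def F_def keys_add_nat keys_sum_nat)
  then have keys: "Poly_Mapping.keys \<alpha> \<subseteq> chessboard m n"
    using s mn by (auto simp: chessboard_def F_def)
  have inside: "\<alpha> + unit_exp a \<in> multiples (nfold_sums t ?E)" if a: "a \<in> chessboard m n - F" for a
  proof -
    obtain r c where rc: "a = (r, c)" by fastforce
    have rc': "1 \<le> r" "r \<le> m" "1 \<le> c" "c \<le> n" "s < r \<longrightarrow> c \<noteq> r"
      using a by (auto simp: chessboard_def F_def rc)
    obtain e b \<delta> where q: "e \<in> {1..s}" and edge: "unit_exp b + unit_exp a \<in> ?E"
      and \<alpha>: "\<alpha> = ((\<Sum>i\<in>{1..s} - {e}. unit_exp (i, 1)) + q) + unit_exp b + \<delta>"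
    proof (cases "r \<le> s")
      case True
      (* A square of the clique in the row of a, or if a is itself in the clique, another one. *)
      define e where "e = (if c \<noteq> 1 then r else if r = 1 then 2 else 1)"
      have e: "e \<in> {1..s}" using True rc' s by (auto simp: e_def)
      have "unit_exp (e, 1) + unit_exp a \<in> ?E"
        using rc' s mn e by (intro rook_edgesI) (auto simp: rc chessboard_def e_def)
      moreover have "\<alpha> = ((\<Sum>i\<in>{1..s} - {e}. unit_exp (i, 1)) + q) + unit_exp (e, 1)
          + (\<Sum>i\<in>{s<..m}. unit_exp (i, i))"
        unfolding \<alpha>_def sum.remove[OF finite_atLeastAtMost e] by (simp only: ac_simps)
      ultimately show ?thesis using that e by blast
    next
      case False
      have one: "1 \<in> {1..s}" and r: "r \<in> {s<..m}" using s False rc' by auto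
      have "unit_exp (r, r) + unit_exp a \<in> ?E"
        using rc' False mn by (intro rook_edgesI) (auto simp: rc chessboard_def)
      moreover have "\<alpha> = ((\<Sum>i\<in>{1..s} - {1}. unit_exp (i, 1)) + q) + unit_exp (r, r)
          + (unit_exp (1, 1) + (\<Sum>i\<in>{s<..m} - {r}. unit_exp (i, i)))"
        unfolding \<alpha>_def sum.remove[OF finite_atLeastAtMost one] sum.remove[OF finite_greaterThanAtMost r]
        by (simp only: ac_simps)
      ultimately show ?thesis using that one by blast
    qed
    have "((\<Sum>i\<in>{1..s} - {e}. unit_exp (i, 1)) + q) + (unit_exp b + unit_exp a) \<in> nfold_sums (t - 1 + 1) ?E"
      by (intro nfold_sums_add column nfold_sums_1 edge q)
    moreover have "t - 1 + 1 = t" using t by simp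
    moreover have "\<alpha> + unit_exp a =
        ((\<Sum>i\<in>{1..s} - {e}. unit_exp (i, 1)) + q) + (unit_exp b + unit_exp a) + \<delta>"
      unfolding \<alpha> by (simp only: ac_simps)
    ultimately show ?thesis using multiplesI by metis
  qed
  have outside: "\<alpha> + \<gamma> \<notin> multiples (nfold_sums t ?E)" if \<gamma>: "Poly_Mapping.keys \<gamma> \<subseteq> F" for \<gamma>
  proof
    have K: "Poly_Mapping.keys (\<alpha> + \<gamma>) \<subseteq> (\<lambda>i. (i, 1)) ` {1..s} \<union> F"
      using keys_\<alpha> \<gamma> by (auto simp: keys_add_nat)
    assume "\<alpha> + \<gamma> \<in> multiples (nfold_sums t ?E)"
    then have "2 * t \<le> weight (- F) (\<alpha> + \<gamma>)"
    proof (rule weight_multiples_nfold_sums)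
      fix \<epsilon> assume "\<epsilon> \<in> ?E" and "Poly_Mapping.keys \<epsilon> \<subseteq> Poly_Mapping.keys (\<alpha> + \<gamma>)"
      then obtain a b where \<epsilon>: "\<epsilon> = unit_exp a + unit_exp b" and ab: "a \<noteq> b"
        "fst a = fst b \<or> snd a = snd b" and "a \<in> Poly_Mapping.keys (\<alpha> + \<gamma>)" "b \<in> Poly_Mapping.keys (\<alpha> + \<gamma>)"
        by (auto simp: rook_edges_def keys_add_nat)
      then have "a \<in> (\<lambda>i. (i, 1)) ` {1..s} \<union> F" "b \<in> (\<lambda>i. (i, 1)) ` {1..s} \<union> F"
        using K by blast+
      then have "a \<notin> F" "b \<notin> F" using ab s by (auto simp: F_def)
      then show "2 \<le> weight (- F) \<epsilon>" by (simp add: \<epsilon> weight_add weight_unit_exp)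
    qed
    moreover have "weight (- F) \<gamma> = 0"
    proof -
      have "Poly_Mapping.keys \<gamma> \<inter> - F = {}" using \<gamma> by blast
      then show ?thesis by (simp add: weight_def)
    qed
    moreover have "weight (- F) (\<Sum>i\<in>{s<..m}. unit_exp (i, i)) = 0"
      by (simp add: weight_sum weight_unit_exp F_def)
    moreover have "weight (- F) (\<Sum>i=1..s. unit_exp (i, 1)) \<le> s"
      using sum_mono[of "{1..s}" "\<lambda>i. weight (- F) (unit_exp (i, 1))" "\<lambda>_. 1"]
      by (simp add: weight_sum weight_unit_exp)
    moreover have "weight (- F) q \<le> 2 * t - 1 - s"
      by (simp add: q_def weight_sum weight_unit_exp)
    ultimately show False using s by (simp add: \<alpha>_def weight_add)
  qed
  have "mon_degree \<alpha> = max m (2 * t - 1)"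
    using s by (simp add: mon_degree_weight \<alpha>_def q_def weight_add weight_sum weight_unit_exp) (auto simp: s_def)
  with v_number_le[where F = F, OF keys inside outside, where 'k = 'k] show ?thesis by simp
qed

section \<open>The v-number\<close>

lemma v_number_rook:
  assumes "1 \<le> m" "m \<le> n" "2 \<le> n" "2 \<le> t"
  shows "v_number (chessboard m n)
      (monomial_ideal (chessboard m n) (nfold_sums t (rook_edges m n)) :: (nat \<times> nat, 'k::field) mpoly set)
    = enat (max m (2 * t - 1))" (is "?v = _")
proof (rule antisym)
  show "?v \<le> enat (max m (2 * t - 1))"
    using v_number_rook_le_of_many_factors[of m n t, where 'k = 'k]
      v_number_rook_le_of_few_factors[of t m n, where 'k = 'k] assms
    by (cases "m \<le> t") (auto simp: max_def split: if_splits)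
  show "enat (max m (2 * t - 1)) \<le> ?v"
  proof (rule enat_le_v_number)
    fix C \<alpha>
    assume "C \<subseteq> chessboard m n"
      and "\<And>a b. unit_exp a + unit_exp b \<in> rook_edges m n \<Longrightarrow> a \<in> C \<or> b \<in> C"
      and "Poly_Mapping.keys \<alpha> \<subseteq> chessboard m n"
      and "\<alpha> \<notin> multiples (nfold_sums t (rook_edges m n))"
      and "\<And>a. a \<in> C \<Longrightarrow> \<alpha> + unit_exp a \<in> multiples (nfold_sums t (rook_edges m n))"
    then show "max m (2 * t - 1) \<le> mon_degree \<alpha>"
      by (rule rook_lower_bound[OF assms])
  qed (rule keys_rook_edges)
qed

text \<open>
  On a single square there are no attacking pairs; all powers vanish and \<open>1\<close> realises the
  prime ideal \<open>0\<close>.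
\<close>

lemma v_number_single_square:
  assumes "1 \<le> t"
  shows "v_number (chessboard 1 1)
      (monomial_ideal (chessboard 1 1) (nfold_sums t (rook_edges 1 1)) :: (nat \<times> nat, 'k::field) mpoly set)
    = 0"
proof -
  have "rook_edges 1 1 = {}" by (auto simp: rook_edges_def chessboard_def)
  then have "nfold_sums t (rook_edges 1 1) = {}" using assms by (cases t) auto
  then have "multiples (nfold_sums t (rook_edges 1 1)) = {}" by (simp add: multiples_def)
  then have "v_number (chessboard 1 1)
      (monomial_ideal (chessboard 1 1) (nfold_sums t (rook_edges 1 1)) :: (nat \<times> nat, 'k) mpoly set)
    \<le> enat (mon_degree (0 :: nat \<times> nat \<Rightarrow>\<^sub>0 nat))"
    by (intro v_number_le[where F = "chessboard 1 1"]) auto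
  then show ?thesis by (simp add: mon_degree_def zero_enat_def[symmetric])
qed

theorem theorem1p2:
  fixes m n t :: nat
    and I :: "(nat \<times> nat, 'k::field) mpoly set"
    and v :: enat
  assumes "n \<ge> m" and "m \<ge> 1" and "t \<ge> 2"
    and "I = stanley_reisner_ideal (chessboard m n) (chessboard_complex m n)"
    and "v = v_number (chessboard m n) (ideal_power (poly_ring (chessboard m n)) I t)"
  shows "(m = 1 \<and> n = 1 \<longrightarrow> v = 0) \<and>
         (n \<ge> m \<and> m \<ge> 4 \<and> 2 \<le> t \<and> real t \<le> real m / 2 \<longrightarrow> v = enat m) \<and>
         (n \<ge> 2 \<and> m = 1 \<longrightarrow> v = enat (2 * t - 1)) \<and>
         (n \<ge> m \<and> m \<ge> 2 \<and> real t \<ge> (real m + 1) / 2 \<longrightarrow> v = enat (2 * t - 1))"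
proof -
  have v: "v = v_number (chessboard m n)
      (monomial_ideal (chessboard m n) (nfold_sums t (rook_edges m n)) :: (nat \<times> nat, 'k) mpoly set)"
    unfolding assms(4,5) stanley_reisner_chessboard
    by (subst ideal_power_monomial_ideal[OF keys_rook_edges]) simp_all
  have single: "v = 0" if "m = 1" "n = 1"
    using v_number_single_square[of t, where 'k = 'k] assms(3) by (simp add: v that)
  have general: "v = enat (max m (2 * t - 1))" if "2 \<le> n"
    unfolding v using v_number_rook[of m n t, where 'k = 'k] assms(1-3) that by simp
  have half: "max m (2 * t - 1) = m" if "real t \<le> real m / 2"
  proof -
    have "real (2 * t) \<le> real m" using that by simp
    then have "2 * t \<le> m" by (simp only: of_nat_le_iff)
    then show ?thesis by simp
  qed
  have half': "max m (2 * t - 1) = 2 * t - 1" if "real t \<ge> (real m + 1) / 2"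
  proof -
    have "real (m + 1) \<le> real (2 * t)" using that by simp
    then have "m + 1 \<le> 2 * t" by (simp only: of_nat_le_iff)
    then show ?thesis by simp
  qed
  have "max 1 (2 * t - 1) = 2 * t - 1" using assms(3) by simp
  then show ?thesis using single general half half' assms(1) by auto
qed

end
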